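(* Let $h$ be a Hessenberg function with degree tuple $\beta=(\beta_n,\ldots,\beta_1)$ and let $R=\mathbb{Z}[x_1,\ldots,x_n]$. Then $R/J_h$ has basis $\{x_1^{\alpha_1}x_2^{\alpha_2}\cdots x_n^{\alpha_n} : 0\le\alpha_i\le\beta_i-1,\ i=1,\ldots,n\}$.
   Context: A Hessenberg function is an $n$-tuple $h=(h_1,\ldots,h_n)$ of integers with $i\le h_i\le n$ and $h_i\le h_{i+1}$. Its degree tuple is $\beta=(\beta_n,\ldots,\beta_1)$ with $\beta_i=i-\#\{k:h_k<i\}$. For $S\subseteq\{1,\ldots,n\}$, $\tilde e_d(S)$ is the sum of all monomials of degree $d$ in $x_i$, $i\in S$, and $\tilde e_d(i,\ldots,n)$ means $S=\{i,\ldots,n\}$. $J_h$ is the ideal of $R$ generated by $\tilde e_{\beta_i}(i,\ldots,n)$, $i=1,\ldots,n$. (The basis is understood via the images of the listed monomials in the quotient.) *)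

theory Defs
  imports "HOL-Library.Poly_Mapping" "HOL-Algebra.QuotRing"
begin

text \<open>
  Polynomials with integer coefficients in the variables \<open>x\<^sub>i\<close>, \<open>i :: nat\<close>, are finitely
  supported maps from exponent vectors to \<open>int\<close>; the multiplication of \<open>poly_mapping\<close> is the
  convolution product.
\<close>

type_synonym zpoly = "(nat \<Rightarrow>\<^sub>0 nat) \<Rightarrow>\<^sub>0 int"

definition X :: "nat \<Rightarrow> zpoly" where
  "X i = Poly_Mapping.single (Poly_Mapping.single i 1) 1"

definition xmon :: "nat set \<Rightarrow> (nat \<Rightarrow> nat) \<Rightarrow> zpoly" where
  "xmon S \<alpha> = (\<Prod>i\<in>S. X i ^ \<alpha> i)"

definition zpoly_ring :: "nat \<Rightarrow> zpoly ring" where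
  "zpoly_ring n =
     \<lparr>carrier = {p. \<forall>m\<in>Poly_Mapping.keys p. Poly_Mapping.keys m \<subseteq> {1..n}},
      mult = (*), one = 1, zero = 0, add = (+)\<rparr>"

definition hessenberg :: "nat \<Rightarrow> (nat \<Rightarrow> nat) \<Rightarrow> bool" where
  "hessenberg n h \<longleftrightarrow>
     (\<forall>i\<in>{1..n}. i \<le> h i \<and> h i \<le> n) \<and> (\<forall>i\<in>{1..<n}. h i \<le> h (i + 1))"

definition hess_beta :: "nat \<Rightarrow> (nat \<Rightarrow> nat) \<Rightarrow> nat \<Rightarrow> nat" where
  "hess_beta n h i = i - card {k \<in> {1..n}. h k < i}"

text \<open>The truncated subtraction above never truncates:\<close>

lemma hess_beta_card_less:
  assumes "hessenberg n h" "i \<in> {1..n}"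
  shows "card {k \<in> {1..n}. h k < i} < i"
proof -
  have "{k \<in> {1..n}. h k < i} \<subseteq> {1..<i}"
    using assms by (force simp: hessenberg_def)
  then have "card {k \<in> {1..n}. h k < i} \<le> card {1..<i}"
    by (rule card_mono[rotated]) simp
  then show ?thesis
    using assms(2) by (auto intro: le_less_trans)
qed

text \<open>
  The sum of all monomials of degree \<open>d\<close> in the variables \<open>x\<^sub>i\<close>, \<open>i \<in> S\<close>, for finite \<open>S\<close>.
  The bound \<open>\<alpha> i \<le> d\<close> is implied by the degree condition.
\<close>

definition etilde :: "nat \<Rightarrow> nat set \<Rightarrow> zpoly" where
  "etilde d S = (\<Sum>\<alpha> | \<alpha> \<in> S \<rightarrow>\<^sub>E {0..d} \<and> (\<Sum>i\<in>S. \<alpha> i) = d. xmon S \<alpha>)"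

definition hess_ideal :: "nat \<Rightarrow> (nat \<Rightarrow> nat) \<Rightarrow> zpoly set" where
  "hess_ideal n h =
     genideal (zpoly_ring n) ((\<lambda>i. etilde (hess_beta n h i) {i..n}) ` {1..n})"

text \<open>
  The family \<open>b\<close>, indexed by \<open>A\<close>, is a basis of the additive group of \<open>G\<close> as a
  \<open>\<int>\<close>-module; linear independence of the family makes \<open>b\<close> injective on \<open>A\<close>
  whenever \<open>G\<close> is an abelian group.
\<close>

definition is_Z_basis :: "('a, 'm) ring_scheme \<Rightarrow> 'i set \<Rightarrow> ('i \<Rightarrow> 'a) \<Rightarrow> bool" where
  "is_Z_basis G A b \<longleftrightarrow>
     b \<in> A \<rightarrow> carrier G \<and>
     (\<forall>x\<in>carrier G. \<exists>F (c :: 'i \<Rightarrow> int). finite F \<and> F \<subseteq> A \<and>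
        x = (\<Oplus>\<^bsub>G\<^esub>a\<in>F. [c a] \<cdot>\<^bsub>G\<^esub> b a)) \<and>
     (\<forall>F (c :: 'i \<Rightarrow> int). finite F \<and> F \<subseteq> A \<and>
        (\<Oplus>\<^bsub>G\<^esub>a\<in>F. [c a] \<cdot>\<^bsub>G\<^esub> b a) = \<zero>\<^bsub>G\<^esub> \<longrightarrow> (\<forall>a\<in>F. c a = 0))"

lemma zpoly_ring_simps [simp]:
  "mult (zpoly_ring n) = (*)" "one (zpoly_ring n) = 1"
  "zero (zpoly_ring n) = 0" "add (zpoly_ring n) = (+)"
  by (simp_all add: zpoly_ring_def)

lemma zpoly_ring_carrier:
  "p \<in> carrier (zpoly_ring n) \<longleftrightarrow>
     (\<forall>m\<in>Poly_Mapping.keys p. Poly_Mapping.keys m \<subseteq> {1..n})"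
  by (simp add: zpoly_ring_def)

lemma zpoly_ring_add_closed:
  "p \<in> carrier (zpoly_ring n) \<Longrightarrow> q \<in> carrier (zpoly_ring n) \<Longrightarrow> p + q \<in> carrier (zpoly_ring n)"
  using Poly_Mapping.keys_add[of p q] unfolding zpoly_ring_carrier by blast

lemma zpoly_ring_mult_closed:
  assumes "p \<in> carrier (zpoly_ring n)" "q \<in> carrier (zpoly_ring n)"
  shows "p * q \<in> carrier (zpoly_ring n)"
  unfolding zpoly_ring_carrier
proof
  fix m assume "m \<in> Poly_Mapping.keys (p * q)"
  then obtain a b where "m = a + b" "a \<in> Poly_Mapping.keys p" "b \<in> Poly_Mapping.keys q"
    using keys_mult[of p q] by blast
  then show "Poly_Mapping.keys m \<subseteq> {1..n}"
    using assms Poly_Mapping.keys_add[of a b] unfolding zpoly_ring_carrier by blast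
qed

lemma zpoly_ring_0: "0 \<in> carrier (zpoly_ring n)" and zpoly_ring_1: "1 \<in> carrier (zpoly_ring n)"
  by (simp_all add: zpoly_ring_carrier)

lemma cring_zpoly_ring: "cring (zpoly_ring n)"
proof (rule cringI)
  have "\<exists>y\<in>carrier (zpoly_ring n). y + x = 0" if "x \<in> carrier (zpoly_ring n)" for x
    using that by (intro bexI[of _ "- x"]) (simp_all add: zpoly_ring_carrier)
  then show "abelian_group (zpoly_ring n)"
    by (intro abelian_groupI)
      (auto simp: zpoly_ring_add_closed zpoly_ring_0 algebra_simps)
  show "comm_monoid (zpoly_ring n)"
    by (intro comm_monoidI)
      (auto simp: zpoly_ring_mult_closed zpoly_ring_1 algebra_simps)
qed (simp add: algebra_simps)

lemma zpoly_ring_xmon: 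
  assumes "S \<subseteq> {1..n}"
  shows "xmon S \<alpha> \<in> carrier (zpoly_ring n)"
proof -
  have "X i ^ k \<in> carrier (zpoly_ring n)" if "i \<in> {1..n}" for i k
    using that by (induction k)
      (auto intro!: zpoly_ring_mult_closed zpoly_ring_1, auto simp: X_def zpoly_ring_carrier)
  then have *: "\<forall>i\<in>S. X i ^ \<alpha> i \<in> carrier (zpoly_ring n)"
    using assms by blast
  have "finite S" using assms finite_subset by blast
  then show ?thesis
    using * unfolding xmon_def
    by (induction S rule: finite_induct) (auto intro: zpoly_ring_mult_closed zpoly_ring_1)
qed

lemma zpoly_ring_etilde:
  assumes "S \<subseteq> {1..n}"
  shows "etilde d S \<in> carrier (zpoly_ring n)"
proof -
  have "sum f B \<in> carrier (zpoly_ring n)" if "\<And>b. f b \<in> carrier (zpoly_ring n)"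
    for f :: "(nat \<Rightarrow> nat) \<Rightarrow> zpoly" and B
    using that by (induction B rule: infinite_finite_induct)
      (auto intro: zpoly_ring_add_closed zpoly_ring_0)
  then show ?thesis
    unfolding etilde_def using zpoly_ring_xmon[OF assms] by blast
qed

lemma finite_etilde_index:
  "finite S \<Longrightarrow> finite {\<alpha>. \<alpha> \<in> S \<rightarrow>\<^sub>E {0..d :: nat} \<and> (\<Sum>i\<in>S. \<alpha> i) = d}"
  by (rule finite_subset[of _ "S \<rightarrow>\<^sub>E {0..d}"]) (auto intro: finite_PiE)

lemma ideal_hess_ideal: "ideal (hess_ideal n h) (zpoly_ring n)"
proof -
  interpret cring "zpoly_ring n" by (rule cring_zpoly_ring)
  show ?thesis
    unfolding hess_ideal_def by (rule genideal_ideal) (auto intro: zpoly_ring_etilde)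
qed

end

theory Submission
  imports Defs
begin

text \<open>
  The generator \<open>f\<^sub>i\<close> is monic of degree \<open>\<beta>\<^sub>i\<close> in \<open>x\<^sub>i\<close> and involves only \<open>x\<^sub>i, \<dots>, x\<^sub>n\<close>.
  Dividing by \<open>f\<^sub>1, f\<^sub>2, \<dots>, f\<^sub>n\<close> in this order never raises the degrees in the variables
  already treated, so the listed monomials span the quotient. Division with remainder by a monic
  polynomial is unique, and this yields independence: in a combination \<open>\<Sum> q\<^sub>i f\<^sub>i\<close> with all
  degrees in \<open>x\<^sub>i\<close> less than \<open>\<beta>\<^sub>i\<close>, the generators can be eliminated one after the other.
\<close>

section \<open>Division by a polynomial that is monic in one variable\<close>

lemma X_power: "X i ^ k = Poly_Mapping.single (Poly_Mapping.single i k) 1"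
  by (induction k) (simp_all add: X_def mult_single flip: single_add)

lemma sum_lookup_single:
  "finite A \<Longrightarrow> Poly_Mapping.keys p \<subseteq> A \<Longrightarrow> (\<Sum>m\<in>A. Poly_Mapping.single m (Poly_Mapping.lookup p m)) = p"
  by (rule poly_mapping_eqI)
    (auto simp: lookup_sum lookup_single when_def in_keys_iff)

lemma lookup_mult_single:
  fixes q :: zpoly
  shows "Poly_Mapping.lookup (q * Poly_Mapping.single s 1) (a + s) = Poly_Mapping.lookup q a"
proof -
  have "q * Poly_Mapping.single s 1
      = (\<Sum>m\<in>Poly_Mapping.keys q. Poly_Mapping.single m (Poly_Mapping.lookup q m)) * Poly_Mapping.single s 1"
    by (simp only: sum_lookup_single[OF finite_keys order_refl])
  also have "\<dots> = (\<Sum>m\<in>Poly_Mapping.keys q. Poly_Mapping.single (m + s) (Poly_Mapping.lookup q m))"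
    by (simp add: sum_distrib_right mult_single)
  finally show ?thesis
    by (auto simp: lookup_sum lookup_single when_def in_keys_iff)
qed

text \<open>Induction on a strict bound for the degree in x_i: the terms of top degree are cancelled
  by a multiple of the divisor, which creates only terms of smaller degree. The set \<open>M\<close>
  carries an invariant of exponents through the division. It later records the degree bounds already
  reached and the range of variables; the condition on \<open>q\<close> keeps the cofactor in the
  ring.\<close>

lemma monic_division:
  fixes p g :: zpoly
  assumes g: "\<And>t. t \<in> Poly_Mapping.keys g \<Longrightarrow> Poly_Mapping.lookup t i < d"
    and M: "\<And>m t. m + Poly_Mapping.single i d \<in> M \<Longrightarrow> t \<in> Poly_Mapping.keys g \<Longrightarrow> m + t \<in> M"
    and p: "Poly_Mapping.keys p \<subseteq> M"
  obtains q r where "p = q * (X i ^ d + g) + r" "Poly_Mapping.keys r \<subseteq> M"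
    "\<And>m. m \<in> Poly_Mapping.keys r \<Longrightarrow> Poly_Mapping.lookup m i < d"
    "\<And>m. m \<in> Poly_Mapping.keys q \<Longrightarrow> m + Poly_Mapping.single i d \<in> M"
proof -
  have "\<exists>q r. p = q * (X i ^ d + g) + r \<and> Poly_Mapping.keys r \<subseteq> M \<and>
      (\<forall>m\<in>Poly_Mapping.keys r. Poly_Mapping.lookup m i < d) \<and>
      (\<forall>m\<in>Poly_Mapping.keys q. m + Poly_Mapping.single i d \<in> M)"
    if "\<forall>m\<in>Poly_Mapping.keys p. Poly_Mapping.lookup m i < k" "Poly_Mapping.keys p \<subseteq> M" for k p
    using that
  proof (induction k arbitrary: p)
    case 0
    then have "p = 0" by simp
    then show ?case by (intro exI[of _ 0]) simp
  next
    case (Suc k)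
    show ?case
    proof (cases "k < d")
      case True
      then show ?thesis
        using Suc.prems by (intro exI[of _ 0] exI[of _ p]) fastforce
    next
      case False
      \<comment> \<open>\<open>H\<close> collects the terms of top degree \<open>k\<close> in x_i,
        \<open>L\<close> the others. The polynomial \<open>u\<close> is the top part divided by
        x_i^d.\<close>
      define H L where "H = {m \<in> Poly_Mapping.keys p. Poly_Mapping.lookup m i = k}"
        and "L = {m \<in> Poly_Mapping.keys p. Poly_Mapping.lookup m i < k}"
      define u lo where
        "u = (\<Sum>m\<in>H. Poly_Mapping.single (m - Poly_Mapping.single i d) (Poly_Mapping.lookup p m))"
        and "lo = (\<Sum>m\<in>L. Poly_Mapping.single m (Poly_Mapping.lookup p m))"
      \<comment> \<open>Subtraction of exponents truncates at 0; it is exact on \<open>H\<close>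
        because d \<le> k.\<close>
      have shift: "m - Poly_Mapping.single i d + Poly_Mapping.single i d = m" if "m \<in> H" for m
        using that False
        by (intro poly_mapping_eqI) (auto simp: H_def lookup_add lookup_minus lookup_single when_def)
      have keys_u: "m + Poly_Mapping.single i d \<in> H" if "m \<in> Poly_Mapping.keys u" for m
      proof -
        have "\<exists>m'\<in>H. m = m' - Poly_Mapping.single i d"
          using that keys_sum[of _ H] unfolding u_def by (fastforce split: if_splits)
        then show ?thesis using shift by auto
      qed
      have keys_lo: "Poly_Mapping.keys lo \<subseteq> L"
        using keys_sum[of _ L] unfolding lo_def by (fastforce split: if_splits)
      have "u * X i ^ d = (\<Sum>m\<in>H. Poly_Mapping.single m (Poly_Mapping.lookup p m))"
        unfolding u_def X_power sum_distrib_right by (rule sum.cong) (simp_all add: mult_single shift)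
      moreover have "H \<inter> L = {}" "H \<union> L = Poly_Mapping.keys p"
        using Suc.prems(1) by (auto simp: H_def L_def)
      moreover have "finite H" "finite L"
        by (simp_all add: H_def L_def)
      ultimately have "p = u * X i ^ d + lo"
        using sum_lookup_single[of "H \<union> L" p]
          sum.union_disjoint[of H L "\<lambda>m. Poly_Mapping.single m (Poly_Mapping.lookup p m)"]
        by (simp add: lo_def)
      \<comment> \<open>Completing x_i^d to the divisor costs \<open>u * g\<close>. Its degree in
        x_i is below (k - d) + d = k, so the induction hypothesis applies to the rest.\<close>
      then have p_eq: "p = u * (X i ^ d + g) + (lo - u * g)"
        by (simp add: algebra_simps)
      have keys_rest: "m \<in> M \<and> Poly_Mapping.lookup m i < k" if m: "m \<in> Poly_Mapping.keys (lo - u * g)" for m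
      proof -
        consider "m \<in> Poly_Mapping.keys lo" | "m \<in> Poly_Mapping.keys (u * g)"
          using m keys_diff[of lo "u * g"] by blast
        then show ?thesis
        proof cases
          case 1
          then show ?thesis using keys_lo Suc.prems by (auto simp: L_def)
        next
          case 2
          then obtain a t where at: "m = a + t" and a: "a \<in> Poly_Mapping.keys u" and t: "t \<in> Poly_Mapping.keys g"
            using keys_mult[of u g] by blast
          have "a + Poly_Mapping.single i d \<in> M" "Poly_Mapping.lookup a i + d = k"
            using keys_u[OF a] Suc.prems(2) by (auto simp: H_def lookup_add)
          then show ?thesis
            using M t g[OF t] by (auto simp: at lookup_add)
        qed
      qed
      then obtain q r where "lo - u * g = q * (X i ^ d + g) + r" "Poly_Mapping.keys r \<subseteq> M"
        "\<forall>m\<in>Poly_Mapping.keys r. Poly_Mapping.lookup m i < d"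
        "\<forall>m\<in>Poly_Mapping.keys q. m + Poly_Mapping.single i d \<in> M"
        using Suc.IH[of "lo - u * g"] by blast
      moreover have "m + Poly_Mapping.single i d \<in> M" if "m \<in> Poly_Mapping.keys u" for m
        using keys_u[OF that] Suc.prems(2) by (auto simp: H_def)
      ultimately show ?thesis
        using p_eq Poly_Mapping.keys_add[of u q]
        by (intro exI[of _ "u + q"] exI[of _ r]) (auto simp: algebra_simps)
    qed
  qed
  \<comment> \<open>Any bound can start the induction; the sum of the degrees of all terms dominates
    each of them.\<close>
  moreover have "\<exists>k. \<forall>m\<in>Poly_Mapping.keys p. Poly_Mapping.lookup m i < k"
    by (rule exI[of _ "Suc (\<Sum>m\<in>Poly_Mapping.keys p. Poly_Mapping.lookup m i)"])
      (auto intro!: member_le_sum le_imp_less_Suc)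
  ultimately obtain q r where "p = q * (X i ^ d + g) + r" "Poly_Mapping.keys r \<subseteq> M"
      "\<forall>m\<in>Poly_Mapping.keys r. Poly_Mapping.lookup m i < d"
      "\<forall>m\<in>Poly_Mapping.keys q. m + Poly_Mapping.single i d \<in> M"
    using p by meson
  then show ?thesis
    by (intro that) auto
qed

text \<open>This is the uniqueness half of division: a term of \<open>q\<close> of maximal degree in
  x_i, multiplied by x_i^d, cannot cancel against \<open>q * g\<close>.\<close>

lemma monic_multiple_low_degree:
  fixes q g :: zpoly
  assumes g: "\<And>t. t \<in> Poly_Mapping.keys g \<Longrightarrow> Poly_Mapping.lookup t i < d"
    and low: "\<And>m. m \<in> Poly_Mapping.keys (q * (X i ^ d + g)) \<Longrightarrow> Poly_Mapping.lookup m i < d"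
  shows "q = 0"
proof (rule ccontr)
  assume "q \<noteq> 0"
  let ?D = "(\<lambda>m. Poly_Mapping.lookup m i) ` Poly_Mapping.keys q"
  have "Max ?D \<in> ?D"
    using \<open>q \<noteq> 0\<close> by (intro Max_in) auto
  then obtain a where a: "a \<in> Poly_Mapping.keys q" and "Poly_Mapping.lookup a i = Max ?D"
    by (metis (lifting) imageE)
  then have max: "Poly_Mapping.lookup b i \<le> Poly_Mapping.lookup a i" if "b \<in> Poly_Mapping.keys q" for b
    using that by simp
  \<comment> \<open>The degree of \<open>?m\<close> in x_i exceeds that of every term of
    \<open>q * g\<close>, so its coefficient in the product is that of \<open>a\<close> in
    \<open>q\<close>, which is nonzero.\<close>
  let ?m = "a + Poly_Mapping.single i d"
  have "?m \<notin> Poly_Mapping.keys (q * g)"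
  proof
    assume "?m \<in> Poly_Mapping.keys (q * g)"
    then obtain b t where "?m = b + t" and b: "b \<in> Poly_Mapping.keys q" and t: "t \<in> Poly_Mapping.keys g"
      using keys_mult[of q g] by blast
    then have "Poly_Mapping.lookup a i + d = Poly_Mapping.lookup b i + Poly_Mapping.lookup t i"
      by (metis lookup_add lookup_single_eq)
    then show False
      using max[OF b] g[OF t] by simp
  qed
  moreover have "Poly_Mapping.lookup (q * X i ^ d) ?m = Poly_Mapping.lookup q a"
    by (simp only: X_power lookup_mult_single)
  ultimately have "?m \<in> Poly_Mapping.keys (q * (X i ^ d + g))"
    using a by (simp add: in_keys_iff distrib_left lookup_add)
  then show False
    using low[of ?m] by (simp add: lookup_add)
qed

section \<open>Exponent vectors of monomials and the leading power of the generators\<close>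

definition expo :: "nat set \<Rightarrow> (nat \<Rightarrow> nat) \<Rightarrow> nat \<Rightarrow>\<^sub>0 nat" where
  "expo S \<alpha> = (\<Sum>k\<in>S. Poly_Mapping.single k (\<alpha> k))"

lemma lookup_expo:
  "finite S \<Longrightarrow> Poly_Mapping.lookup (expo S \<alpha>) j = (if j \<in> S then \<alpha> j else 0)"
  by (simp add: expo_def lookup_sum lookup_single when_def)

lemma keys_expo_subset: "finite S \<Longrightarrow> Poly_Mapping.keys (expo S \<alpha>) \<subseteq> S"
  by (auto simp: in_keys_iff lookup_expo split: if_splits)

lemma expo_lookup: "finite S \<Longrightarrow> Poly_Mapping.keys m \<subseteq> S \<Longrightarrow> expo S (Poly_Mapping.lookup m) = m"
  by (rule poly_mapping_eqI) (auto simp: lookup_expo in_keys_iff)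

lemma expo_restrict: "expo S (restrict \<alpha> S) = expo S \<alpha>"
  by (simp add: expo_def)

lemma inj_on_expo:
  assumes "finite S"
  shows "inj_on (expo S) (Pi\<^sub>E S B)"
proof (rule inj_onI)
  fix \<alpha> \<beta> assume *: "\<alpha> \<in> Pi\<^sub>E S B" "\<beta> \<in> Pi\<^sub>E S B" and eq: "expo S \<alpha> = expo S \<beta>"
  have "\<alpha> i = \<beta> i" if "i \<in> S" for i
    using lookup_expo[OF assms, of \<alpha> i] lookup_expo[OF assms, of \<beta> i] that eq by simp
  with * show "\<alpha> = \<beta>" by (rule PiE_ext)
qed

lemma xmon_eq_single: "finite S \<Longrightarrow> xmon S \<alpha> = Poly_Mapping.single (expo S \<alpha>) 1"
  unfolding xmon_def expo_def
  by (induction S rule: finite_induct) (simp_all add: X_power mult_single)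

text \<open>Among the monomials of total degree \<open>d\<close>, only x_i^d reaches degree
  \<open>d\<close> in x_i; \<open>g\<close> is the sum of the others.\<close>

lemma etilde_monic:
  assumes "i \<le> n"
  obtains g where "etilde d {i..n} = X i ^ d + g"
    "\<And>t. t \<in> Poly_Mapping.keys g \<Longrightarrow> Poly_Mapping.lookup t i < d"
    "\<And>t. t \<in> Poly_Mapping.keys g \<Longrightarrow> Poly_Mapping.keys t \<subseteq> {i..n}"
proof
  let ?S = "{i..n}"
  let ?A = "{\<alpha>. \<alpha> \<in> ?S \<rightarrow>\<^sub>E {0..d} \<and> (\<Sum>k\<in>?S. \<alpha> k) = d}"
  let ?a = "\<lambda>k\<in>?S. if k = i then d else 0"
  let ?g = "\<Sum>\<alpha>\<in>?A - {?a}. xmon ?S \<alpha>"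
  have i: "i \<in> ?S" using assms by simp
  have "(\<Sum>k\<in>?S. ?a k) = (\<Sum>k\<in>?S. if k = i then d else 0)"
    by (rule sum.cong) auto
  then have "?a \<in> ?A" using i by auto
  moreover have "expo ?S ?a = Poly_Mapping.single i d"
    using i by (intro poly_mapping_eqI) (auto simp: lookup_expo lookup_single when_def)
  then have "xmon ?S ?a = X i ^ d"
    by (simp add: xmon_eq_single X_power)
  ultimately show "etilde d ?S = X i ^ d + ?g"
    unfolding etilde_def using sum.remove[OF finite_etilde_index[of ?S d], of ?a "xmon ?S"] by simp
  fix t assume "t \<in> Poly_Mapping.keys ?g"
  then obtain \<alpha> where \<alpha>: "\<alpha> \<in> ?A" "\<alpha> \<noteq> ?a" and t: "t = expo ?S \<alpha>"
    using keys_sum[of "xmon ?S" "?A - {?a}"] by (auto simp: xmon_eq_single)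
  show "Poly_Mapping.keys t \<subseteq> ?S"
    by (simp add: t keys_expo_subset)
  \<comment> \<open>If x_i used up the whole degree, all other exponents on \<open>?S\<close> would
    vanish, and extensionality would give \<open>?a\<close>.\<close>
  have "\<alpha> i \<noteq> d"
  proof
    assume *: "\<alpha> i = d"
    have "(\<Sum>k\<in>?S. \<alpha> k) = \<alpha> i + (\<Sum>k\<in>?S - {i}. \<alpha> k)"
      using i by (simp add: sum.remove)
    then have "\<forall>k\<in>?S - {i}. \<alpha> k = 0"
      using \<alpha>(1) * by simp
    then have "\<alpha> = ?a"
      using \<alpha>(1) * by (intro ext) (auto simp: PiE_def extensional_def)
    then show False using \<alpha>(2) by simp
  qed
  moreover have "\<alpha> i \<le> d"
    using \<alpha>(1) i by (auto simp: PiE_iff)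
  ultimately show "Poly_Mapping.lookup t i < d"
    using i by (simp add: t lookup_expo)
qed

section \<open>Triangular systems of monic polynomials: existence and uniqueness of reduced
  remainders\<close>

locale monic_triangular =
  fixes n :: nat and d :: "nat \<Rightarrow> nat" and g :: "nat \<Rightarrow> zpoly"
  assumes deg: "i \<in> {1..n} \<Longrightarrow> t \<in> Poly_Mapping.keys (g i) \<Longrightarrow> Poly_Mapping.lookup t i < d i"
    and vars: "i \<in> {1..n} \<Longrightarrow> t \<in> Poly_Mapping.keys (g i) \<Longrightarrow> Poly_Mapping.keys t \<subseteq> {i..n}"
begin

definition f :: "nat \<Rightarrow> zpoly" where
  "f i = X i ^ d i + g i"

text \<open>Within the ring in x_1, ..., x_n, these are the integer combinations of the monomials of
  the claimed basis.\<close>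

definition reduced :: "zpoly \<Rightarrow> bool" where
  "reduced p \<longleftrightarrow> (\<forall>m\<in>Poly_Mapping.keys p. \<forall>i\<in>{1..n}. Poly_Mapping.lookup m i < d i)"

text \<open>This is the triangular shape: multiplying by \<open>f i\<close> leaves the degrees in
  all earlier variables unchanged.\<close>

lemma lookup_keys_f:
  assumes "i \<in> {1..n}" "j < i" "t \<in> Poly_Mapping.keys (f i)"
  shows "Poly_Mapping.lookup t j = 0"
proof -
  have "t = Poly_Mapping.single i (d i) \<or> t \<in> Poly_Mapping.keys (g i)"
    using assms(3) Poly_Mapping.keys_add[of "X i ^ d i" "g i"] by (auto simp: f_def X_power)
  then show ?thesis
    using vars[OF assms(1)] assms(2) by (fastforce simp: lookup_single in_keys_iff)
qed

lemma ex_reduced: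
  assumes "p \<in> carrier (zpoly_ring n)"
  obtains q r where "p = (\<Sum>i\<in>{1..n}. q i * f i) + r" "r \<in> carrier (zpoly_ring n)"
    "\<And>i. i \<in> {1..n} \<Longrightarrow> q i \<in> carrier (zpoly_ring n)" "reduced r"
proof -
  have "\<exists>q r. p = (\<Sum>i\<in>{1..j}. q i * f i) + r \<and> (\<forall>i\<in>{1..j}. q i \<in> carrier (zpoly_ring n)) \<and>
      r \<in> carrier (zpoly_ring n) \<and>
      (\<forall>m\<in>Poly_Mapping.keys r. \<forall>i\<in>{1..j}. Poly_Mapping.lookup m i < d i)" if "j \<le> n" for j
    using that
  proof (induction j)
    case 0
    then show ?case using assms by simp
  next
    case (Suc j)
    then obtain q r where p: "p = (\<Sum>i\<in>{1..j}. q i * f i) + r"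
      and q: "\<forall>i\<in>{1..j}. q i \<in> carrier (zpoly_ring n)" and r: "r \<in> carrier (zpoly_ring n)"
        "\<forall>m\<in>Poly_Mapping.keys r. \<forall>i\<in>{1..j}. Poly_Mapping.lookup m i < d i"
      by auto
    let ?k = "Suc j"
    have k: "?k \<in> {1..n}" using Suc.prems by simp
    \<comment> \<open>The invariant for the division by \<open>f ?k\<close>: the remainder stays in
      the ring and keeps the bounds in x_1, ..., x_j. It is preserved because \<open>g ?k\<close> is
      free of those variables.\<close>
    let ?M = "{m. Poly_Mapping.keys m \<subseteq> {1..n} \<and> (\<forall>i\<in>{1..j}. Poly_Mapping.lookup m i < d i)}"
    have M: "m + t \<in> ?M" if m: "m + Poly_Mapping.single ?k (d ?k) \<in> ?M" and t: "t \<in> Poly_Mapping.keys (g ?k)" for m t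
    proof -
      have "Poly_Mapping.keys m \<subseteq> Poly_Mapping.keys (m + Poly_Mapping.single ?k (d ?k))"
        by (auto simp: in_keys_iff lookup_add)
      then have "Poly_Mapping.keys (m + t) \<subseteq> {1..n}"
        using m vars[OF k t] Poly_Mapping.keys_add[of m t] by fastforce
      moreover have "Poly_Mapping.lookup t i = 0" if "i \<le> j" for i
        using vars[OF k t] that by (auto simp: in_keys_iff)
      ultimately show ?thesis
        using m by (auto simp: lookup_add)
    qed
    have "Poly_Mapping.keys r \<subseteq> ?M"
      using r by (auto simp: zpoly_ring_carrier)
    then obtain q' r' where r': "r = q' * f ?k + r'" "Poly_Mapping.keys r' \<subseteq> ?M"
        "\<And>m. m \<in> Poly_Mapping.keys r' \<Longrightarrow> Poly_Mapping.lookup m ?k < d ?k"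
        and q': "\<And>m. m \<in> Poly_Mapping.keys q' \<Longrightarrow> m + Poly_Mapping.single ?k (d ?k) \<in> ?M"
      using monic_division[of "g ?k" ?k "d ?k" ?M r, OF deg[OF k] M] unfolding f_def by blast
    have "q' \<in> carrier (zpoly_ring n)"
      unfolding zpoly_ring_carrier
    proof
      fix m assume "m \<in> Poly_Mapping.keys q'"
      moreover have "Poly_Mapping.keys m \<subseteq> Poly_Mapping.keys (m + Poly_Mapping.single ?k (d ?k))"
        by (auto simp: in_keys_iff lookup_add)
      ultimately show "Poly_Mapping.keys m \<subseteq> {1..n}"
        using q' by blast
    qed
    moreover have "p = (\<Sum>i\<in>{1..?k}. (q(?k := q')) i * f i) + r'"
      by (simp add: p r'(1) algebra_simps)
    moreover have "r' \<in> carrier (zpoly_ring n)"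
      using r'(2) by (auto simp: zpoly_ring_carrier)
    moreover have "\<forall>m\<in>Poly_Mapping.keys r'. \<forall>i\<in>{1..?k}. Poly_Mapping.lookup m i < d i"
    proof (intro ballI)
      fix m i assume m: "m \<in> Poly_Mapping.keys r'" and i: "i \<in> {1..?k}"
      then show "Poly_Mapping.lookup m i < d i"
        using r'(2,3) by (cases "i = ?k") (auto simp: subset_iff)
    qed
    ultimately show ?case
      using q by (intro exI[of _ "q(?k := q')"] exI[of _ r']) auto
  qed
  from this[of n] show ?thesis
    using that by (auto simp: reduced_def)
qed

text \<open>Reducing the cofactors of \<open>f\<^sub>j\<^sub>+\<^sub>1, \<dots>, f\<^sub>n\<close> modulo \<open>f\<^sub>j\<close> leaves a multiple of \<open>f\<^sub>j\<close>
  of degree less than \<open>d\<^sub>j\<close> in \<open>x\<^sub>j\<close>, which vanishes.\<close>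

lemma reduced_combination_eq_0:
  assumes red: "reduced (\<Sum>i\<in>{1..n}. q i * f i)"
  shows "(\<Sum>i\<in>{1..n}. q i * f i) = 0"
proof -
  define p where "p = (\<Sum>i\<in>{1..n}. q i * f i)"
  \<comment> \<open>The generators are eliminated from the front, with cofactors that change along
    the way. At \<open>j = n\<close> the sum is empty, so p = 0.\<close>
  have "\<exists>q. p = (\<Sum>i\<in>{Suc j..n}. q i * f i)" if "j \<le> n" for j
    using that
  proof (induction j)
    case 0
    show ?case by (rule exI[of _ q]) (simp add: p_def)
  next
    case (Suc j)
    then obtain q where p: "p = (\<Sum>i\<in>{Suc j..n}. q i * f i)"
      by (meson Suc_leD)
    let ?k = "Suc j"
    have k: "?k \<in> {1..n}" using Suc.prems by simp
    have "\<exists>a b. q i = a * f ?k + b \<and> (\<forall>m\<in>Poly_Mapping.keys b. Poly_Mapping.lookup m ?k < d ?k)" for i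
    proof (rule monic_division[of "g ?k" ?k "d ?k" UNIV "q i"])
      fix a b assume "q i = a * (X ?k ^ d ?k + g ?k) + b"
        "\<And>m. m \<in> Poly_Mapping.keys b \<Longrightarrow> Poly_Mapping.lookup m ?k < d ?k"
      then show ?thesis
        unfolding f_def by blast
    qed (simp_all add: deg[OF k])
    then obtain a b where ab: "\<And>i. q i = a i * f ?k + b i"
        and b: "\<And>i m. m \<in> Poly_Mapping.keys (b i) \<Longrightarrow> Poly_Mapping.lookup m ?k < d ?k"
      by metis
    let ?T = "{Suc ?k..n}"
    \<comment> \<open>Since \<open>q i * f i = a i * f i * f ?k + b i * f i\<close>, the multiples
      of \<open>f ?k\<close> gather in \<open>c\<close> and the rest is \<open>s\<close>.\<close>
    define c where "c = q ?k + (\<Sum>i\<in>?T. a i * f i)"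
    define s where "s = (\<Sum>i\<in>?T. b i * f i)"
    have "{?k..n} = insert ?k ?T" using k by auto
    then have "p = q ?k * f ?k + (\<Sum>i\<in>?T. q i * f i)"
      by (simp add: p)
    also have "\<dots> = c * f ?k + s"
      unfolding c_def s_def distrib_right sum_distrib_right add.assoc sum.distrib[symmetric]
      by (intro arg_cong2[where f = "(+)"] sum.cong refl) (simp add: ab algebra_simps)
    finally have pcs: "p = c * f ?k + s" .
    \<comment> \<open>The factors \<open>f i\<close> in \<open>s\<close> have i > \<open>?k\<close>
      and are free of the variable with index \<open>?k\<close>, so the bound on \<open>b i\<close>
      passes to the products. As \<open>p\<close> is reduced, \<open>c * f ?k = p - s\<close> then
      has low degree too.\<close>
    have "Poly_Mapping.lookup m ?k < d ?k" if m: "m \<in> Poly_Mapping.keys s" for m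
    proof -
      obtain i where i: "i \<in> ?T" "m \<in> Poly_Mapping.keys (b i * f i)"
        using m keys_sum[of "\<lambda>i. b i * f i" ?T] by (auto simp: s_def)
      then obtain u v where "m = u + v" and uv: "u \<in> Poly_Mapping.keys (b i)" "v \<in> Poly_Mapping.keys (f i)"
        using keys_mult[of "b i" "f i"] by blast
      then show ?thesis
        using b[OF uv(1)] lookup_keys_f[of i ?k v] i(1) by (auto simp: lookup_add)
    qed
    moreover have "Poly_Mapping.lookup m ?k < d ?k" if "m \<in> Poly_Mapping.keys p" for m
      using red that k by (auto simp: reduced_def p_def)
    ultimately have "Poly_Mapping.lookup m ?k < d ?k" if "m \<in> Poly_Mapping.keys (c * f ?k)" for m
      using that keys_diff[of p s] pcs by auto
    then have "c = 0"
      using monic_multiple_low_degree[of "g ?k" ?k "d ?k" c] deg[OF k] by (auto simp: f_def)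
    then show ?case
      using pcs by (auto simp: s_def)
  qed
  from this[of n] show ?thesis
    by (simp add: p_def)
qed

end

section \<open>Sums, multiples, ideals and cosets in the ring of polynomials\<close>

lemma zpoly_ring_sum_closed:
  "(\<And>a. a \<in> A \<Longrightarrow> p a \<in> carrier (zpoly_ring n)) \<Longrightarrow> (\<Sum>a\<in>A. p a) \<in> carrier (zpoly_ring n)"
  by (induction A rule: infinite_finite_induct) (simp_all add: zpoly_ring_add_closed zpoly_ring_0)

lemma zpoly_ring_uminus_closed:
  "p \<in> carrier (zpoly_ring n) \<Longrightarrow> - p \<in> carrier (zpoly_ring n)"
  by (simp add: zpoly_ring_carrier)

lemma zpoly_ring_a_inv:
  assumes "p \<in> carrier (zpoly_ring n)"
  shows "\<ominus>\<^bsub>zpoly_ring n\<^esub> p = - p"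
proof -
  interpret cring "zpoly_ring n" by (rule cring_zpoly_ring)
  show ?thesis
    using minus_equality[of "- p" p] assms by (simp add: zpoly_ring_uminus_closed)
qed

lemma zpoly_ring_finsum:
  assumes "finite A" "\<And>a. a \<in> A \<Longrightarrow> p a \<in> carrier (zpoly_ring n)"
  shows "(\<Oplus>\<^bsub>zpoly_ring n\<^esub>a\<in>A. p a) = (\<Sum>a\<in>A. p a)"
proof -
  interpret cring "zpoly_ring n" by (rule cring_zpoly_ring)
  show ?thesis
    using assms by (induction A rule: finite_induct) (simp_all add: Pi_def)
qed

lemma zpoly_ring_add_pow:
  fixes c :: int
  assumes "p \<in> carrier (zpoly_ring n)"
  shows "[c] \<cdot>\<^bsub>zpoly_ring n\<^esub> p = of_int c * p"
proof -
  interpret cring "zpoly_ring n" by (rule cring_zpoly_ring)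
  have nat: "[k] \<cdot>\<^bsub>zpoly_ring n\<^esub> p = of_nat k * p" for k :: nat
    using assms by (induction k) (simp_all add: algebra_simps)
  have "of_nat k * p \<in> carrier (zpoly_ring n)" for k :: nat
    using add.nat_pow_closed[OF assms, of k] by (simp add: nat)
  from zpoly_ring_a_inv[OF this[of "nat (- c)"]] show ?thesis
    by (cases "c \<ge> 0") (simp_all add: add_pow_int_ge add_pow_int_lt nat)
qed

text \<open>The combinations with cofactors in the ring form an ideal containing the generators, and
  \<open>genideal\<close> is the least such ideal.\<close>

lemma zpoly_ring_genideal_combination:
  assumes I: "finite I" and f: "f ` I \<subseteq> carrier (zpoly_ring n)"
    and p: "p \<in> genideal (zpoly_ring n) (f ` I)"
  obtains q where "p = (\<Sum>i\<in>I. q i * f i)"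
proof -
  interpret cring "zpoly_ring n" by (rule cring_zpoly_ring)
  let ?K = "{\<Sum>i\<in>I. q i * f i | q. \<forall>i\<in>I. q i \<in> carrier (zpoly_ring n)}"
  have "ideal ?K (zpoly_ring n)"
  proof (rule idealI)
    have l: "x * a \<in> ?K" if "a \<in> ?K" "x \<in> carrier (zpoly_ring n)" for a x
    proof -
      obtain q where "a = (\<Sum>i\<in>I. q i * f i)" "\<forall>i\<in>I. q i \<in> carrier (zpoly_ring n)"
        using \<open>a \<in> ?K\<close> by blast
      then show ?thesis
        using that(2) zpoly_ring_mult_closed
        by (auto simp: sum_distrib_left mult.assoc intro!: exI[of _ "\<lambda>i. x * q i"])
    qed
    show "subgroup ?K (add_monoid (zpoly_ring n))"
    proof (rule add.subgroupI)
      show "?K \<subseteq> carrier (zpoly_ring n)"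
        using f by (auto intro!: zpoly_ring_sum_closed zpoly_ring_mult_closed)
      show "?K \<noteq> {}"
        using zpoly_ring_0 by auto
      show "\<ominus>\<^bsub>zpoly_ring n\<^esub> a \<in> ?K" if "a \<in> ?K" for a
      proof -
        \<comment> \<open>Negation is multiplication by the ring element -1, so closure under
          multiples covers additive inverses.\<close>
        have "\<ominus>\<^bsub>zpoly_ring n\<^esub> a = - 1 * a"
          using that \<open>?K \<subseteq> carrier (zpoly_ring n)\<close> by (subst zpoly_ring_a_inv) auto
        moreover have "- 1 * a \<in> ?K"
          by (rule l[OF that]) (rule zpoly_ring_uminus_closed[OF zpoly_ring_1])
        ultimately show ?thesis by (simp only:)
      qed
      show "a \<oplus>\<^bsub>zpoly_ring n\<^esub> b \<in> ?K" if ab: "a \<in> ?K" "b \<in> ?K" for a b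
      proof -
        obtain q q' where "a = (\<Sum>i\<in>I. q i * f i)" "\<forall>i\<in>I. q i \<in> carrier (zpoly_ring n)"
          "b = (\<Sum>i\<in>I. q' i * f i)" "\<forall>i\<in>I. q' i \<in> carrier (zpoly_ring n)"
          using ab by blast
        then show ?thesis
          using zpoly_ring_add_closed
          by (auto simp: sum.distrib distrib_right intro!: exI[of _ "\<lambda>i. q i + q' i"])
      qed
    qed
    show "x \<otimes>\<^bsub>zpoly_ring n\<^esub> a \<in> ?K" "a \<otimes>\<^bsub>zpoly_ring n\<^esub> x \<in> ?K"
      if "a \<in> ?K" "x \<in> carrier (zpoly_ring n)" for a x
      using l[OF that] by (simp_all add: mult.commute)
  qed (rule ring_axioms)
  moreover have "f ` I \<subseteq> ?K"
  proof
    fix y assume "y \<in> f ` I"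
    then obtain j where j: "j \<in> I" "y = f j" by blast
    have "(\<Sum>i\<in>I. (if i = j then 1 else 0) * f i) = (\<Sum>i\<in>I. if i = j then f i else 0)"
      by (rule sum.cong) auto
    then have "y = (\<Sum>i\<in>I. (if i = j then 1 else 0) * f i)"
      using j I by simp
    moreover have "\<forall>i\<in>I. (if i = j then 1 else 0) \<in> carrier (zpoly_ring n)"
      by (simp add: zpoly_ring_0 zpoly_ring_1)
    ultimately show "y \<in> ?K"
      by (intro CollectI exI[of _ "\<lambda>i. if i = j then 1 else 0"] conjI)
  qed
  ultimately have "genideal (zpoly_ring n) (f ` I) \<subseteq> ?K"
    by (rule genideal_minimal)
  then show ?thesis
    using p that by blast
qed

text \<open>The projection to the quotient is a ring homomorphism and commutes with finite sums and
  integer multiples. Questions about combinations of cosets thus become questions about one explicit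
  polynomial.\<close>

lemma zpoly_quot_combination:
  fixes c :: "(nat \<Rightarrow> nat) \<Rightarrow> int"
  assumes J: "ideal J (zpoly_ring n)" and "finite F" and S: "S \<subseteq> {1..n}"
  shows "(\<Oplus>\<^bsub>zpoly_ring n Quot J\<^esub>\<alpha>\<in>F. [c \<alpha>] \<cdot>\<^bsub>zpoly_ring n Quot J\<^esub> (J +>\<^bsub>zpoly_ring n\<^esub> xmon S \<alpha>))
    = J +>\<^bsub>zpoly_ring n\<^esub> (\<Sum>\<alpha>\<in>F. Poly_Mapping.single (expo S \<alpha>) (c \<alpha>))"
proof -
  let ?R = "zpoly_ring n"
  interpret R: cring ?R by (rule cring_zpoly_ring)
  interpret ideal J ?R by (rule J)
  interpret h: ring_hom_cring ?R "?R Quot J" "(+>\<^bsub>?R\<^esub>) J"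
    by (rule rcos_ring_hom_cring) (rule R.cring_axioms)
  have S': "finite S" using S finite_subset by blast
  have mon: "of_int c * xmon S \<alpha> = Poly_Mapping.single (expo S \<alpha>) c" for c \<alpha>
    by (simp add: xmon_eq_single[OF S'] mult_single flip: single_of_int)
  have closed: "Poly_Mapping.single (expo S \<alpha>) c \<in> carrier ?R" for c \<alpha>
    using keys_expo_subset[OF S', of \<alpha>] S by (auto simp: zpoly_ring_carrier)
  \<comment> \<open>Integer multiples in a ring are powers in its additive group, hence the passage
    to group homomorphisms.\<close>
  interpret ah: group_hom "add_monoid ?R" "add_monoid (?R Quot J)" "(+>\<^bsub>?R\<^esub>) J"
    by (rule h.ring.a_group_hom)
  have "[c] \<cdot>\<^bsub>?R Quot J\<^esub> (J +>\<^bsub>?R\<^esub> xmon S \<alpha>) = J +>\<^bsub>?R\<^esub> Poly_Mapping.single (expo S \<alpha>) c"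
    for c :: int and \<alpha>
    using ah.hom_int_pow[of "xmon S \<alpha>" c] zpoly_ring_xmon[OF S, of \<alpha>] zpoly_ring_add_pow[of "xmon S \<alpha>" n c]
    by (simp add: add_pow_def mon)
  then show ?thesis
    using h.hom_finsum[of "\<lambda>\<alpha>. Poly_Mapping.single (expo S \<alpha>) (c \<alpha>)" F] closed \<open>finite F\<close>
    by (simp add: zpoly_ring_finsum comp_def)
qed

text \<open>Extensional exponent functions have distinct exponent vectors, so no two terms merge.
  Hence a vanishing sum has vanishing coefficients.\<close>

lemma lookup_sum_expo:
  assumes "F \<subseteq> Pi\<^sub>E S B" "finite S" "finite F" "\<alpha> \<in> F"
  shows "Poly_Mapping.lookup (\<Sum>\<alpha>\<in>F. Poly_Mapping.single (expo S \<alpha>) (c \<alpha>)) (expo S \<alpha>) = c \<alpha>"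
proof -
  have "expo S \<beta> = expo S \<alpha> \<longleftrightarrow> \<beta> = \<alpha>" if "\<beta> \<in> F" for \<beta>
    using inj_on_expo[OF assms(2), of B] assms(1,4) that by (meson inj_onD subsetD)
  then have "(\<Sum>\<beta>\<in>F. Poly_Mapping.lookup (Poly_Mapping.single (expo S \<beta>) (c \<beta>)) (expo S \<alpha>))
      = (\<Sum>\<beta>\<in>F. if \<beta> = \<alpha> then c \<beta> else 0)"
    by (intro sum.cong) (auto simp: lookup_single when_def)
  then show ?thesis
    using assms(3,4) by (simp add: lookup_sum)
qed

section \<open>The monomial basis of the quotient by the Hessenberg ideal\<close>

theorem theorem5p11:
  fixes n :: nat and h :: "nat \<Rightarrow> nat"
  assumes "hessenberg n h"
  shows "is_Z_basis (zpoly_ring n Quot hess_ideal n h)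
           (\<Pi>\<^sub>E i\<in>{1..n}. {0..hess_beta n h i - 1})
           (\<lambda>\<alpha>. hess_ideal n h +>\<^bsub>zpoly_ring n\<^esub> xmon {1..n} \<alpha>)"
proof -
  let ?R = "zpoly_ring n" and ?J = "hess_ideal n h" and ?d = "hess_beta n h"
  let ?A = "\<Pi>\<^sub>E i\<in>{1..n}. {0..?d i - 1}"
  let ?comb = "\<lambda>F c. \<Sum>\<alpha>\<in>F. Poly_Mapping.single (expo {1..n} \<alpha>) (c \<alpha> :: int)"
  interpret R: cring ?R by (rule cring_zpoly_ring)
  interpret J: ideal ?J ?R by (rule ideal_hess_ideal)
  \<comment> \<open>Positivity turns the bound \<open>?d i - 1\<close>, a truncated subtraction,
    into the strict bound required by \<open>reduced\<close>.\<close>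
  have d_pos: "?d i > 0" if "i \<in> {1..n}" for i
    using hess_beta_card_less[OF assms that] by (simp add: hess_beta_def)
  have "\<exists>g. etilde (?d i) {i..n} = X i ^ ?d i + g \<and>
      (\<forall>t\<in>Poly_Mapping.keys g. Poly_Mapping.lookup t i < ?d i \<and> Poly_Mapping.keys t \<subseteq> {i..n})"
    if "i \<in> {1..n}" for i
    using that etilde_monic[of i n "?d i"] by (metis atLeastAtMost_iff)
  then obtain g where g: "\<And>i. i \<in> {1..n} \<Longrightarrow> etilde (?d i) {i..n} = X i ^ ?d i + g i"
      "\<And>i t. i \<in> {1..n} \<Longrightarrow> t \<in> Poly_Mapping.keys (g i) \<Longrightarrow>
        Poly_Mapping.lookup t i < ?d i \<and> Poly_Mapping.keys t \<subseteq> {i..n}"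
    by metis
  interpret monic_triangular n ?d g
    by standard (use g(2) in blast)+
  have gens: "(\<lambda>i. etilde (?d i) {i..n}) ` {1..n} = f ` {1..n}"
    using g(1) by (auto simp: f_def)
  have f_carrier: "f ` {1..n} \<subseteq> carrier ?R"
    unfolding gens[symmetric] by (auto intro: zpoly_ring_etilde)
  have f_J: "f ` {1..n} \<subseteq> ?J"
    unfolding hess_ideal_def gens by (rule R.genideal_self[OF f_carrier])
  have comb: "(\<Oplus>\<^bsub>?R Quot ?J\<^esub>\<alpha>\<in>F. [c \<alpha>] \<cdot>\<^bsub>?R Quot ?J\<^esub> (?J +>\<^bsub>?R\<^esub> xmon {1..n} \<alpha>))
    = ?J +>\<^bsub>?R\<^esub> ?comb F c" if "finite F" for F and c :: "(nat \<Rightarrow> nat) \<Rightarrow> int"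
    by (rule zpoly_quot_combination[OF ideal_hess_ideal that]) simp
  have finA: "finite ?A" by (intro finite_PiE) auto

  show ?thesis
    unfolding is_Z_basis_def
  proof (intro conjI allI impI ballI)
    show "(\<lambda>\<alpha>. ?J +>\<^bsub>?R\<^esub> xmon {1..n} \<alpha>) \<in> ?A \<rightarrow> carrier (?R Quot ?J)"
      using zpoly_ring_xmon[of "{1..n}" n] by (auto simp: FactRing_def A_RCOSETS_def')
  next
    fix x assume "x \<in> carrier (?R Quot ?J)"
    then obtain p where p: "p \<in> carrier ?R" "x = ?J +>\<^bsub>?R\<^esub> p"
      by (auto simp: FactRing_def A_RCOSETS_def')
    obtain q r where qr: "p = (\<Sum>i\<in>{1..n}. q i * f i) + r" "r \<in> carrier ?R"
        "\<And>i. i \<in> {1..n} \<Longrightarrow> q i \<in> carrier ?R" "reduced r"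
      using ex_reduced[OF p(1)] by blast
    have "(\<Sum>i\<in>T. q i * f i) \<in> ?J" if "T \<subseteq> {1..n}" for T
      using finite_subset[OF that finite_atLeastAtMost] that
    proof (induction T rule: finite_induct)
      case empty
      then show ?case using J.zero_closed by simp
    next
      case (insert i T)
      then have "q i * f i \<in> ?J"
        using J.I_l_closed[of "f i" "q i"] f_J qr(3)[of i] by (simp add: image_subset_iff)
      then show ?case
        using insert J.a_closed by simp
    qed
    then have "(\<Sum>i\<in>{1..n}. q i * f i) \<in> ?J" by blast
    then have "?J +>\<^bsub>?R\<^esub> (\<Sum>i\<in>{1..n}. q i * f i) = ?J"
      by (rule J.a_rcos_const)
    then have "x = ?J +>\<^bsub>?R\<^esub> r"
      using R.a_coset_add_assoc[of ?J "\<Sum>i\<in>{1..n}. q i * f i" r] J.a_subset qr(2)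
        \<open>(\<Sum>i\<in>{1..n}. q i * f i) \<in> ?J\<close> by (simp add: p(2) qr(1) subset_iff)
    moreover have r: "r = ?comb ?A (\<lambda>\<alpha>. Poly_Mapping.lookup r (expo {1..n} \<alpha>))"
    proof -
      have "Poly_Mapping.keys r \<subseteq> expo {1..n} ` ?A"
      proof
        fix m assume m: "m \<in> Poly_Mapping.keys r"
        \<comment> \<open>The restriction makes the exponent function extensional, as the index set
          \<open>?A\<close> demands; \<open>expo\<close> ignores values outside {1..n}.\<close>
        then have "m = expo {1..n} (restrict (Poly_Mapping.lookup m) {1..n})"
          using qr(2) by (simp add: expo_restrict expo_lookup zpoly_ring_carrier)
        moreover have "restrict (Poly_Mapping.lookup m) {1..n} \<in> ?A"
        proof (rule restrict_PiE_iff[THEN iffD2], rule ballI)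
          fix i assume "i \<in> {1..n}"
          then have "Poly_Mapping.lookup m i < ?d i"
            using m qr(4) by (simp add: reduced_def)
          then show "Poly_Mapping.lookup m i \<in> {0..?d i - 1}" by simp
        qed
        ultimately show "m \<in> expo {1..n} ` ?A" by blast
      qed
      then have "(\<Sum>m\<in>expo {1..n} ` ?A. Poly_Mapping.single m (Poly_Mapping.lookup r m)) = r"
        using finA by (intro sum_lookup_single) auto
      then show ?thesis
        by (simp add: sum.reindex inj_on_expo)
    qed
    ultimately have "x = ?J +>\<^bsub>?R\<^esub> ?comb ?A (\<lambda>\<alpha>. Poly_Mapping.lookup r (expo {1..n} \<alpha>))"
      by (simp only: flip: r)
    \<comment> \<open>The witnesses are all of \<open>?A\<close> and the coefficients of the
      remainder \<open>r\<close>, many of which may be 0.\<close>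
    from this[folded comb[OF finA]] show "\<exists>F (c :: (nat \<Rightarrow> nat) \<Rightarrow> int). finite F \<and> F \<subseteq> ?A \<and>
        x = (\<Oplus>\<^bsub>?R Quot ?J\<^esub>\<alpha>\<in>F. [c \<alpha>] \<cdot>\<^bsub>?R Quot ?J\<^esub> (?J +>\<^bsub>?R\<^esub> xmon {1..n} \<alpha>))"
      using finA by (intro exI conjI) (assumption, rule order_refl)
  next
    fix F and c :: "(nat \<Rightarrow> nat) \<Rightarrow> int" and \<alpha>
    assume F: "finite F \<and> F \<subseteq> ?A \<and>
        (\<Oplus>\<^bsub>?R Quot ?J\<^esub>\<alpha>\<in>F. [c \<alpha>] \<cdot>\<^bsub>?R Quot ?J\<^esub> (?J +>\<^bsub>?R\<^esub> xmon {1..n} \<alpha>)) = \<zero>\<^bsub>?R Quot ?J\<^esub>"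
      and \<alpha>: "\<alpha> \<in> F"
    \<comment> \<open>The relation says that \<open>?p\<close> lies in the ideal, so it is a
      combination of the generators. The index set makes it reduced, and by elimination it vanishes
      as a polynomial.\<close>
    let ?p = "?comb F c"
    have keys_p: "Poly_Mapping.keys ?p \<subseteq> expo {1..n} ` F"
      using keys_sum[of "\<lambda>\<alpha>. Poly_Mapping.single (expo {1..n} \<alpha>) (c \<alpha>)" F]
      by (auto split: if_splits)
    have "?p \<in> carrier ?R"
      using keys_p keys_expo_subset[of "{1..n}"] by (fastforce simp: zpoly_ring_carrier)
    moreover have "?J +>\<^bsub>?R\<^esub> ?p = ?J"
      using F comb[of F c] by (simp add: FactRing_def)
    ultimately have "?p \<in> ?J"
      by (rule J.rcos_const_imp_mem)
    then obtain q where q: "?p = (\<Sum>i\<in>{1..n}. q i * f i)"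
      using zpoly_ring_genideal_combination[OF _ f_carrier] unfolding hess_ideal_def gens by blast
    have "reduced ?p"
      unfolding reduced_def
    proof (intro ballI)
      fix m i assume m: "m \<in> Poly_Mapping.keys ?p" and i: "i \<in> {1..n}"
      then obtain \<beta> where "\<beta> \<in> ?A" "m = expo {1..n} \<beta>"
        using keys_p F by blast
      then have "Poly_Mapping.lookup m i \<le> ?d i - 1"
        using i by (auto simp: lookup_expo PiE_iff)
      then show "Poly_Mapping.lookup m i < ?d i"
        using d_pos[OF i] by simp
    qed
    then have "?p = 0"
      unfolding q by (rule reduced_combination_eq_0)
    then show "c \<alpha> = 0"
      using lookup_sum_expo[of F "{1..n}" "\<lambda>i. {0..?d i - 1}" \<alpha> c] F \<alpha> by simp
  qed
qed

end
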